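(* Let $d\ge 1$ and let $k_1,\ldots,k_d$ be positive integers. Then, as $n\to\infty$, $$f(n,R^{k_1,\ldots,k_d},d)=O\left(n^{d-\alpha(k_1,\ldots,k_d)}\right),\qquad\text{where } \alpha(k_1,\ldots,k_d)=\frac{\max(k_1,\ldots,k_d)}{k_1\cdot k_2\cdots k_d}.$$
   Context: A $d$-dimensional $n_1\times\cdots\times n_d$ zero-one matrix is an array $A=(a_{i_1,\ldots,i_d})$, $1\le i_\ell\le n_\ell$, with entries in $\{0,1\}$. A submatrix is obtained by selecting, for each $\ell$, a set of values of the $\ell$-th coordinate (keeping the order). $A$ contains a $d$-dimensional zero-one matrix $P$ if some submatrix of $A$ can be transformed into $P$ by changing any number of ones to zeros; otherwise $A$ avoids $P$. $f(n,P,d)$ denotes the maximum number of ones in a $d$-dimensional $n\times\cdots\times n$ zero-one matrix that avoids $P$. $R^{k_1,\ldots,k_d}$ denotes the $d$-dimensional $k_1\times\cdots\times k_d$ matrix of all ones. The implied constant may depend on $d,k_1,\ldots,k_d$ but not on $n$. *)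

theory Defs
  imports Complex_Main "HOL-Library.FuncSet" "HOL-Library.Landau_Symbols"
begin

text \<open>A multidimensional matrix carries its side lengths \<open>[n\<^sub>1, \<dots>, n\<^sub>d]\<close>; the dimension \<open>d\<close> is
  the length of that list. Positions are lists \<open>[i\<^sub>1, \<dots>, i\<^sub>d]\<close>, with coordinates counted from 1.\<close>

datatype matrix = Matrix (dims: "nat list") (entry: "nat list \<Rightarrow> nat")

definition positions :: "nat list \<Rightarrow> nat list set" where
  "positions ns = listset (map (\<lambda>n. {1..n}) ns)"

definition zero_one_matrices :: "nat list \<Rightarrow> matrix set" where
  "zero_one_matrices ns = {A. dims A = ns \<and> entry A \<in> positions ns \<rightarrow>\<^sub>E {0, 1}}"

definition num_ones :: "matrix \<Rightarrow> nat" where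
  "num_ones A = card {i \<in> positions (dims A). entry A i = 1}"

text \<open>\<open>Ss ! l\<close> is the set of selected values of coordinate \<open>l\<close>. Keeping the order means that
  the new value \<open>j\<close> of that coordinate stands for the \<open>j\<close>-th smallest element of \<open>Ss ! l\<close>.\<close>

definition selection :: "matrix \<Rightarrow> nat set list \<Rightarrow> bool" where
  "selection A Ss \<longleftrightarrow> list_all2 (\<lambda>S n. S \<subseteq> {1..n}) Ss (dims A)"

definition submatrix :: "matrix \<Rightarrow> nat set list \<Rightarrow> matrix" where
  "submatrix A Ss = Matrix (map card Ss)
     (\<lambda>js \<in> positions (map card Ss).
        entry A (map2 (\<lambda>S j. sorted_list_of_set S ! (j - 1)) Ss js))"

definition ones_to_zeros :: "matrix \<Rightarrow> matrix \<Rightarrow> bool" where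
  "ones_to_zeros B P \<longleftrightarrow> dims P = dims B \<and>
     (\<forall>i \<in> positions (dims B). entry P i = entry B i \<or> entry B i = 1 \<and> entry P i = 0)"

definition contains :: "matrix \<Rightarrow> matrix \<Rightarrow> bool" where
  "contains A P \<longleftrightarrow> (\<exists>Ss. selection A Ss \<and> ones_to_zeros (submatrix A Ss) P)"

abbreviation avoids :: "matrix \<Rightarrow> matrix \<Rightarrow> bool" where
  "avoids A P \<equiv> \<not> contains A P"

text \<open>The set under \<open>Max\<close> is finite, and it is nonempty as soon as \<open>P\<close> has a one, because the
  zero matrix then avoids \<open>P\<close>.\<close>

definition max_ones :: "nat \<Rightarrow> matrix \<Rightarrow> nat \<Rightarrow> nat" where
  "max_ones n P d =
     Max {num_ones A | A. A \<in> zero_one_matrices (replicate d n) \<and> avoids A P}"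

definition all_ones :: "nat list \<Rightarrow> matrix" where
  "all_ones ks = Matrix ks (\<lambda>i \<in> positions ks. 1)"

definition alpha :: "nat list \<Rightarrow> real" where
  "alpha ks = real (Max (set ks)) / real (prod_list ks)"

end

theory Submission
  imports Defs "HOL-Analysis.Convex"
begin

text \<open>Let \<open>B\<close> be the set of ones of a matrix of side \<open>n\<close> and density \<open>\<delta>\<close> avoiding the all-ones matrix,
  let \<open>k\<^sub>m\<close> be the largest side, and let \<open>K = \<Prod>\<^sub>i\<^sub>\<noteq>\<^sub>m k\<^sub>i\<close>, \<open>s = \<Sum>\<^sub>i\<^sub>\<noteq>\<^sub>m k\<^sub>i\<close>. Count the grids inside \<open>B\<close> given by
  \<open>k\<^sub>i\<close> values (possibly repeated) of each coordinate \<open>i \<noteq> m\<close> and a single value of coordinate \<open>m\<close>.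
  The power mean inequality, applied one coordinate at a time, yields at least \<open>\<delta>\<^sup>K n\<^sup>s\<^sup>+\<^sup>1\<close> of them.
  On the other hand only \<open>O(n\<^sup>s)\<close> of them repeat a value, and among the others each choice outside
  coordinate \<open>m\<close> extends in fewer than \<open>k\<^sub>m\<close> ways. Hence \<open>\<delta>\<^sup>K = O(1/n)\<close>.\<close>

section \<open>Tuples, grids and their numbers\<close>

lemma mem_listset_iff: "xs \<in> listset As \<longleftrightarrow> list_all2 (\<in>) xs As"
  by (induction As arbitrary: xs) (auto simp: set_Cons_def list_all2_Cons2)

text \<open>This power \<open>X\<close> to the \<open>k\<close> serves two purposes: for the
  positions of a cube with side \<open>X\<close>, and for the lists of values chosen in one
  coordinate of a grid.\<close>

definition tuples :: "'a set \<Rightarrow> nat \<Rightarrow> 'a list set" where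
  "tuples X k = {xs. set xs \<subseteq> X \<and> length xs = k}"

text \<open>Chosen values form lists, not sets, so repetitions are allowed. This makes the choices
  independent and turns the counts into exact powers; degenerate grids are subtracted later.\<close>

definition grids :: "'a set \<Rightarrow> nat list \<Rightarrow> 'a list list set" where
  "grids X ks = {xss. list_all2 (\<lambda>xs k. xs \<in> tuples X k) xss ks}"

definition grids_in :: "'a set \<Rightarrow> nat list \<Rightarrow> 'a list set \<Rightarrow> 'a list list set" where
  "grids_in X ks B = {xss \<in> grids X ks. listset (map set xss) \<subseteq> B}"

lemma finite_tuples: "finite X \<Longrightarrow> finite (tuples X k)"
  unfolding tuples_def by (rule finite_lists_length_eq)

lemma card_tuples: "finite X \<Longrightarrow> card (tuples X k) = card X ^ k"
  unfolding tuples_def by (rule card_lists_length_eq)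

lemma tuples_Suc: "tuples X (Suc k) = (\<lambda>(x, xs). x # xs) ` (X \<times> tuples X k)"
  by (auto simp: tuples_def length_Suc_conv image_iff)

lemma grids_Nil: "grids X [] = {[]}"
  by (auto simp: grids_def)

lemma grids_Cons: "grids X (k # ks) = (\<lambda>(xs, xss). xs # xss) ` (tuples X k \<times> grids X ks)"
  by (auto simp: grids_def list_all2_Cons2 image_iff)

lemma inj_Cons_pair: "inj_on (\<lambda>(x, xs). x # xs) A"
  by (auto simp: inj_on_def)

lemma finite_grids: "finite X \<Longrightarrow> finite (grids X ks)"
  by (induction ks) (auto simp: grids_Nil grids_Cons finite_tuples)

lemma card_grids: "finite X \<Longrightarrow> card (grids X ks) = card X ^ sum_list ks"
  by (induction ks)
    (auto simp: grids_Nil grids_Cons card_image inj_Cons_pair card_cartesian_product card_tuples power_add)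

lemma finite_grids_in: "finite X \<Longrightarrow> finite (grids_in X ks B)"
  unfolding grids_in_def by (simp add: finite_grids)

section \<open>Lower bound for the number of grids inside a set\<close>

lemma power_mean_sum:
  fixes f :: "'a \<Rightarrow> real"
  assumes "finite S" "S \<noteq> {}" "\<And>x. x \<in> S \<Longrightarrow> f x \<ge> 0"
  shows "card S * ((\<Sum>x\<in>S. f x) / card S) ^ k \<le> (\<Sum>x\<in>S. f x ^ k)"
proof -
  \<comment> \<open>Odd powers are convex only on the nonnegative half-line, hence the restriction
    to \<open>{0..}\<close>.\<close>
  have "convex_on {0..} (\<lambda>x::real. x ^ k)"
    by (cases "even k") (auto intro: convex_power_odd convex_on_subset[OF convex_power_even])
  from convex_on_sum[OF assms(1,2) this, of "\<lambda>_. 1 / card S" f]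
  have "((\<Sum>x\<in>S. f x) / card S) ^ k \<le> (\<Sum>x\<in>S. f x ^ k) / card S"
    using assms by (simp add: sum_divide_distrib)
  moreover have "real (card S) > 0"
    using assms by (simp add: card_gt_0_iff)
  ultimately show ?thesis
    by (simp only: pos_le_divide_eq mult.commute)
qed

text \<open>Double counting of pairs \<open>(xs, l)\<close>: for a fixed tail \<open>l\<close>, the
  entries of \<open>xs\<close> range independently over the heads that \<open>B\<close> allows
  before \<open>l\<close>.\<close>

lemma sum_card_common_link:
  assumes "finite X"
  shows "(\<Sum>xs\<in>tuples X k. card {l \<in> tuples X d. \<forall>x\<in>set xs. x # l \<in> B})
    = (\<Sum>l\<in>tuples X d. card {x \<in> X. x # l \<in> B} ^ k)"
proof (rule sum_multicount_gen)
  show "\<forall>l\<in>tuples X d. card {xs \<in> tuples X k. \<forall>x\<in>set xs. x # l \<in> B} = card {x \<in> X. x # l \<in> B} ^ k"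
  proof
    fix l
    have "{xs \<in> tuples X k. \<forall>x\<in>set xs. x # l \<in> B} = tuples {x \<in> X. x # l \<in> B} k"
      by (auto simp: tuples_def)
    then show "card {xs \<in> tuples X k. \<forall>x\<in>set xs. x # l \<in> B} = card {x \<in> X. x # l \<in> B} ^ k"
      using assms by (simp add: card_tuples)
  qed
qed (use assms in \<open>auto simp: finite_tuples\<close>)

lemma sum_card_link:
  assumes "finite X" "B \<subseteq> tuples X (Suc d)"
  shows "(\<Sum>l\<in>tuples X d. card {x \<in> X. x # l \<in> B}) = card B"
proof -
  let ?P = "Sigma (tuples X d) (\<lambda>l. {x \<in> X. x # l \<in> B})"
  have eq: "B = (\<lambda>(l, x). x # l) ` ?P"
  proof (intro equalityI subsetI)
    fix b assume "b \<in> B"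
    moreover from this obtain x l where "b = x # l" "x \<in> X" "l \<in> tuples X d"
      using assms(2) by (auto simp: tuples_Suc)
    ultimately show "b \<in> (\<lambda>(l, x). x # l) ` ?P"
      by (intro image_eqI[of _ _ "(l, x)"]) auto
  qed auto
  have "inj_on (\<lambda>(l, x). x # l) ?P"
    by (auto simp: inj_on_def)
  then have "card B = card ?P"
    by (subst eq) (rule card_image)
  also have "\<dots> = (\<Sum>l\<in>tuples X d. card {x \<in> X. x # l \<in> B})"
    using assms(1) by (intro card_SigmaI) (auto simp: finite_tuples)
  finally show ?thesis ..
qed

text \<open>Slicing off the first coordinate: once its values \<open>xs\<close> are chosen, the rest
  must be a grid inside the common link of \<open>xs\<close>, the set of tails that every entry of
  \<open>xs\<close> extends into \<open>B\<close>. This recursion drives the induction for the lower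
  bound.\<close>

lemma card_grids_in_Cons:
  assumes "finite X"
  shows "card (grids_in X (k # ks) B) = (\<Sum>xs\<in>tuples X k.
    card (grids_in X ks {l \<in> tuples X (length ks). \<forall>x\<in>set xs. x # l \<in> B}))"
proof -
  let ?L = "\<lambda>xs. {l \<in> tuples X (length ks). \<forall>x\<in>set xs. x # l \<in> B}"
  have sub: "listset (map set xss) \<subseteq> tuples X (length ks)" if "xss \<in> grids X ks" for xss
    using that
    by (fastforce simp: mem_listset_iff grids_def tuples_def list_all2_conv_all_nth in_set_conv_nth)
  have "grids_in X (k # ks) B = (\<lambda>(xs, xss). xs # xss) ` Sigma (tuples X k) (\<lambda>xs. grids_in X ks (?L xs))"
  proof (intro equalityI subsetI)
    fix yss assume "yss \<in> grids_in X (k # ks) B"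
    then obtain xs xss where yss: "yss = xs # xss" and xs: "xs \<in> tuples X k" and xss: "xss \<in> grids X ks"
      and "set_Cons (set xs) (listset (map set xss)) \<subseteq> B"
      by (auto simp: grids_in_def grids_Cons)
    then have "listset (map set xss) \<subseteq> ?L xs"
      using sub[OF xss] by (auto simp: set_Cons_def)
    with yss xs xss show "yss \<in> (\<lambda>(xs, xss). xs # xss) ` Sigma (tuples X k) (\<lambda>xs. grids_in X ks (?L xs))"
      by (auto simp: grids_in_def)
  next
    fix yss assume "yss \<in> (\<lambda>(xs, xss). xs # xss) ` Sigma (tuples X k) (\<lambda>xs. grids_in X ks (?L xs))"
    then show "yss \<in> grids_in X (k # ks) B"
      by (fastforce simp: grids_in_def grids_Cons set_Cons_def)
  qed
  then show ?thesis
    using assms by (simp add: card_image inj_Cons_pair finite_tuples finite_grids_in)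
qed

text \<open>A Sidorenko-type inequality, by induction on \<open>ks\<close>. Convexity enters twice
  per coordinate: over tails, to bound the total size of the common links, and over tuples
  \<open>xs\<close>, to average the bound that the induction hypothesis gives for each link.\<close>

lemma card_grids_in_ge:
  assumes "finite X" "X \<noteq> {}" "B \<subseteq> tuples X (length ks)"
  shows "real (card X) ^ sum_list ks * (card B / real (card X) ^ length ks) ^ prod_list ks
    \<le> card (grids_in X ks B)"
  using assms(3)
proof (induction ks arbitrary: B)
  case Nil
  then have "B = {} \<or> B = {[]}"
    by (auto simp: tuples_def)
  then show ?case
  proof
    assume "B = {[]}"
    moreover from this have "grids_in X [] B = {[]}"
      by (auto simp: grids_in_def grids_Nil)
    ultimately show ?thesis
      by simp
  qed simp
next
  case (Cons k ks)
  let ?n = "real (card X)" and ?d = "length ks"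
  let ?L = "\<lambda>xs. {l \<in> tuples X ?d. \<forall>x\<in>set xs. x # l \<in> B}"
  have n: "?n > 0"
    using assms by (simp add: card_gt_0_iff)
  have ne: "tuples X j \<noteq> {}" for j
    using assms card_tuples[of X j] by (metis card.empty card_0_eq power_not_zero)
  define \<sigma> where "\<sigma> = (\<Sum>xs\<in>tuples X k. card (?L xs) / ?n ^ ?d)"
  \<comment> \<open>First use of convexity, with exponent \<open>k\<close>: the numbers of heads
    above the tails sum to \<open>card B\<close>.\<close>
  have "?n ^ ?d * (card B / ?n ^ ?d) ^ k \<le> (\<Sum>l\<in>tuples X ?d. real (card {x \<in> X. x # l \<in> B}) ^ k)"
    using power_mean_sum[OF finite_tuples[OF assms(1)] ne[of ?d],
        where f = "\<lambda>l. real (card {x \<in> X. x # l \<in> B})" and k = k]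
      sum_card_link[of X B ?d] assms(1) Cons.prems
    by (simp add: card_tuples flip: of_nat_sum)
  also have "\<dots> = (\<Sum>xs\<in>tuples X k. card (?L xs))"
    using sum_card_common_link[OF assms(1), of ?d B k] by (simp flip: of_nat_power of_nat_sum)
  also have "\<dots> = ?n ^ ?d * \<sigma>"
    using n by (simp add: \<sigma>_def flip: sum_divide_distrib)
  finally have \<sigma>: "(card B / ?n ^ ?d) ^ k \<le> \<sigma>"
    using n by simp
  have "?n ^ k * (card B / ?n ^ Suc ?d) ^ (k * prod_list ks) = ?n ^ k * ((card B / ?n ^ ?d) ^ k / ?n ^ k) ^ prod_list ks"
    by (simp add: power_mult power_divide power_mult_distrib)
  also have "\<dots> \<le> ?n ^ k * (\<sigma> / ?n ^ k) ^ prod_list ks"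
    using \<sigma> n by (intro mult_left_mono power_mono divide_right_mono) auto
  \<comment> \<open>Second use of convexity, with exponent \<open>prod_list ks\<close>: \<sigma> is
    the sum of the link densities over the \<open>?n ^ k\<close> tuples.\<close>
  also have "\<dots> \<le> (\<Sum>xs\<in>tuples X k. (card (?L xs) / ?n ^ ?d) ^ prod_list ks)"
    using power_mean_sum[OF finite_tuples[OF assms(1)] ne,
        where f = "\<lambda>xs. card (?L xs) / ?n ^ ?d" and k = "prod_list ks"]
      assms(1)
    by (simp add: card_tuples \<sigma>_def)
  finally have "?n ^ sum_list ks * (?n ^ k * (card B / ?n ^ Suc ?d) ^ (k * prod_list ks))
      \<le> ?n ^ sum_list ks * (\<Sum>xs\<in>tuples X k. (card (?L xs) / ?n ^ ?d) ^ prod_list ks)"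
    using n by (intro mult_left_mono) auto
  also have "\<dots> = (\<Sum>xs\<in>tuples X k. ?n ^ sum_list ks * (card (?L xs) / ?n ^ ?d) ^ prod_list ks)"
    by (rule sum_distrib_left)
  also have "\<dots> \<le> (\<Sum>xs\<in>tuples X k. real (card (grids_in X ks (?L xs))))"
    by (intro sum_mono Cons.IH) auto
  also have "\<dots> = card (grids_in X (k # ks) B)"
    using card_grids_in_Cons[OF assms(1), of k ks B] by simp
  finally show ?case
    by (simp add: power_add algebra_simps)
qed

section \<open>Upper bounds: degenerate grids and sets without a full box\<close>

lemma card_nondistinct_tuples:
  assumes "finite X"
  shows "card {xs \<in> tuples X k. \<not> distinct xs} * card X \<le> k\<^sup>2 * card X ^ k"
proof (induction k)
  case 0
  have "{xs \<in> tuples X 0. \<not> distinct xs} = {}"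
    by (auto simp: tuples_def)
  then show ?case
    by (simp only: card.empty)
next
  case (Suc k)
  let ?D = "\<lambda>k. {xs \<in> tuples X k. \<not> distinct xs}"
  \<comment> \<open>Either the tail already repeats a value, or the head is one of the at most
    \<open>k\<close> values of the tail. The generous factor \<open>k\<^sup>2\<close> absorbs the
    sum, since \<open>k\<^sup>2 + k\<close> is at most \<open>(Suc k)\<^sup>2\<close>.\<close>
  have "?D (Suc k) \<subseteq> (\<lambda>(x, xs). x # xs) ` (X \<times> ?D k) \<union> (\<lambda>(xs, x). x # xs) ` Sigma (tuples X k) set"
    by (force simp: tuples_Suc image_iff)
  moreover have "finite (X \<times> ?D k)" "finite (Sigma (tuples X k) set)"
    using assms by (auto simp: finite_tuples)
  ultimately have "card (?D (Suc k)) \<le> card (X \<times> ?D k) + card (Sigma (tuples X k) set)"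
    by (smt (verit) card_image_le card_mono card_Un_le add_mono finite_UnI finite_imageI le_trans)
  also have "card (Sigma (tuples X k) set) = (\<Sum>xs\<in>tuples X k. card (set xs))"
    using assms by (simp add: finite_tuples)
  also have "\<dots> \<le> (\<Sum>xs\<in>tuples X k. k)"
    by (rule sum_mono) (auto simp: tuples_def card_length)
  also have "\<dots> = card X ^ k * k"
    using assms by (simp add: card_tuples)
  finally have "card (?D (Suc k)) * card X \<le> (card X * card (?D k) + card X ^ k * k) * card X"
    by (simp add: card_cartesian_product)
  also have "\<dots> = card X * (card (?D k) * card X) + k * card X ^ Suc k"
    by (simp add: algebra_simps)
  also have "\<dots> \<le> card X * (k\<^sup>2 * card X ^ k) + k * card X ^ Suc k"
    using Suc by (intro add_mono mult_left_mono) auto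
  also have "\<dots> = (k\<^sup>2 + k) * card X ^ Suc k"
    by (simp add: algebra_simps)
  also have "\<dots> \<le> (Suc k)\<^sup>2 * card X ^ Suc k"
    by (intro mult_right_mono) (auto simp: power2_eq_square)
  finally show ?case .
qed

text \<open>A union bound over the coordinate in which a repetition occurs. Multiplying by
  \<open>card X\<close> on the left avoids the exponent \<open>sum_list ks - 1\<close> on the
  naturals.\<close>

lemma card_nondistinct_grids:
  assumes "finite X"
  shows "card {xss \<in> grids X ks. \<not> list_all distinct xss} * card X
    \<le> (\<Sum>k\<leftarrow>ks. k\<^sup>2) * card X ^ sum_list ks"
proof (induction ks)
  case Nil
  have "{xss \<in> grids X []. \<not> list_all distinct xss} = {}"
    by (auto simp: grids_Nil)
  then show ?case
    by (simp only: card.empty)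
next
  case (Cons k ks)
  let ?D = "{xs \<in> tuples X k. \<not> distinct xs}"
  let ?E = "\<lambda>ks. {xss \<in> grids X ks. \<not> list_all distinct xss}"
  have "?E (k # ks) \<subseteq> (\<lambda>(xs, xss). xs # xss) ` (?D \<times> grids X ks) \<union> (\<lambda>(xs, xss). xs # xss) ` (tuples X k \<times> ?E ks)"
    by (force simp: grids_Cons image_iff)
  moreover have "finite (?D \<times> grids X ks)" "finite (tuples X k \<times> ?E ks)"
    using assms by (auto simp: finite_tuples finite_grids)
  ultimately have "card (?E (k # ks)) \<le> card (?D \<times> grids X ks) + card (tuples X k \<times> ?E ks)"
    by (smt (verit) card_image_le card_mono card_Un_le add_mono finite_UnI finite_imageI le_trans)
  then have "card (?E (k # ks)) * card X
      \<le> (card ?D * card X ^ sum_list ks + card X ^ k * card (?E ks)) * card X"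
    using assms by (simp add: card_cartesian_product card_grids card_tuples)
  also have "\<dots> = (card ?D * card X) * card X ^ sum_list ks + card X ^ k * (card (?E ks) * card X)"
    by (simp add: algebra_simps)
  also have "\<dots> \<le> (k\<^sup>2 * card X ^ k) * card X ^ sum_list ks
      + card X ^ k * ((\<Sum>k\<leftarrow>ks. k\<^sup>2) * card X ^ sum_list ks)"
    using Cons card_nondistinct_tuples[OF assms, of k] by (intro add_mono mult_left_mono mult_right_mono) auto
  also have "\<dots> = (\<Sum>k\<leftarrow>k # ks. k\<^sup>2) * card X ^ sum_list (k # ks)"
    by (simp add: algebra_simps power_add)
  finally show ?case .
qed

text \<open>Grids are grouped by their values outside coordinate \<open>m\<close>. If more than
  \<open>ks ! m\<close> single values completed the same choice, \<open>ks ! m\<close> of them would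
  form, together with that choice, a full box inside \<open>B\<close>.\<close>

lemma card_distinct_grids_in:
  assumes "finite X" "m < length ks" "ks ! m > 0"
    and free: "\<And>Ss. list_all2 (\<lambda>S k. S \<subseteq> X \<and> card S = k) Ss ks \<Longrightarrow> \<not> listset Ss \<subseteq> B"
  shows "card {xss \<in> grids_in X (ks[m := 1]) B. list_all distinct xss}
    \<le> ks ! m * card X ^ sum_list (ks[m := 0])"
proof -
  let ?H = "{xss \<in> grids_in X (ks[m := 1]) B. list_all distinct xss}"
  let ?Z = "grids X (ks[m := 0])"
  \<comment> \<open>The empty list at index \<open>m\<close> of \<open>zss\<close>, forced by the
    length 0 in \<open>ks[m := 0]\<close>, is a placeholder; \<open>Y zss\<close> collects the
    values that may fill it.\<close>
  define Y where "Y zss = {y. zss[m := [y]] \<in> ?H}" for zss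
  have mem: "list_all2 (\<lambda>xs k. xs \<in> tuples X k) (xss[m := xs]) (ks[m := k])"
    if "list_all2 (\<lambda>xs k. xs \<in> tuples X k) xss (ks[m := j])" "xs \<in> tuples X k" for xss xs j k
    using list_all2_update_cong[where i = m, OF that] by simp
  have "?H \<subseteq> (\<lambda>(zss, y). zss[m := [y]]) ` Sigma ?Z Y"
  proof
    fix xss assume xss: "xss \<in> ?H"
    then have "list_all2 (\<lambda>xs k. xs \<in> tuples X k) xss (ks[m := 1])"
      by (simp add: grids_in_def grids_def)
    moreover from this have "xss ! m \<in> tuples X 1"
      using assms(2) by (auto simp: list_all2_conv_all_nth)
    then obtain y where "xss ! m = [y]"
      by (auto simp: tuples_def length_Suc_conv)
    then have "xss = xss[m := [], m := [y]]"
      by (metis list_update_id list_update_overwrite)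
    moreover have "xss[m := []] \<in> ?Z"
      using mem[of xss 1 "[]" 0] calculation by (auto simp: grids_def tuples_def)
    ultimately show "xss \<in> (\<lambda>(zss, y). zss[m := [y]]) ` Sigma ?Z Y"
      using xss by (intro image_eqI[of _ _ "(xss[m := []], y)"]) (auto simp: Y_def)
  qed
  moreover have YX: "Y zss \<subseteq> X" if "zss \<in> ?Z" for zss
  proof
    fix y assume "y \<in> Y zss"
    then have "list_all2 (\<lambda>xs k. xs \<in> tuples X k) (zss[m := [y]]) (ks[m := 1])"
      by (simp add: Y_def grids_in_def grids_def)
    then show "y \<in> X"
      using assms(2) by (auto simp: list_all2_conv_all_nth tuples_def dest!: spec[of _ m])
  qed
  moreover have "finite (Sigma ?Z Y)"
    using assms(1) by (intro finite_SigmaI finite_grids finite_subset[OF YX])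
  ultimately have "card ?H \<le> card (Sigma ?Z Y)"
    by (meson card_image_le card_mono finite_imageI le_trans)
  also have "\<dots> = (\<Sum>zss\<in>?Z. card (Y zss))"
    using assms(1) finite_subset[OF YX] by (simp add: finite_grids)
  also have "\<dots> \<le> (\<Sum>zss\<in>?Z. ks ! m)"
  proof (rule sum_mono, rule ccontr)
    fix zss assume z: "zss \<in> ?Z" and "\<not> card (Y zss) \<le> ks ! m"
    then obtain S where S: "S \<subseteq> Y zss" "card S = ks ! m"
      by (meson nat_le_linear obtain_subset_with_card_n)
    \<comment> \<open>One completion by some \<open>y\<close> is enough to know that the tuples of
      \<open>zss\<close> outside \<open>m\<close> are distinct, so that their sets have the required
      sizes.\<close>
    from S assms(3) obtain y where y: "y \<in> S"
      by (metis card.empty ex_in_conv less_irrefl)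
    have len: "length zss = length ks"
      using z by (auto simp: grids_def dest: list_all2_lengthD)
    let ?Ss = "(map set zss)[m := S]"
    have "list_all2 (\<lambda>S k. S \<subseteq> X \<and> card S = k) ?Ss ks"
      unfolding list_all2_conv_all_nth
    proof (intro conjI allI impI)
      fix i assume i: "i < length ?Ss"
      have "zss[m := [y]] \<in> ?H"
        using y S by (auto simp: Y_def)
      then have "zss[m := [y]] ! i \<in> tuples X (ks[m := 1] ! i)" "distinct (zss[m := [y]] ! i)"
        using i by (auto simp: grids_in_def grids_def list_all2_conv_all_nth list_all_length)
      then show "?Ss ! i \<subseteq> X" "card (?Ss ! i) = ks ! i"
        using S YX[OF z] i len by (cases "i = m"; force simp: tuples_def distinct_card)+
    qed (simp add: len)
    then have "\<not> listset ?Ss \<subseteq> B"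
      by (rule free)
    then obtain l where "l \<in> listset ?Ss" and lB: "l \<notin> B"
      by blast
    then have l: "list_all2 (\<in>) l ?Ss"
      by (simp only: mem_listset_iff)
    \<comment> \<open>Each point \<open>l\<close> of the box lies in the grid completed by its own
      coordinate \<open>l ! m\<close>, and that grid is inside \<open>B\<close>.\<close>
    then have "l ! m \<in> S"
      using len assms(2) by (auto simp: list_all2_conv_all_nth)
    then have "listset (map set (zss[m := [l ! m]])) \<subseteq> B"
      using S by (auto simp: Y_def grids_in_def)
    moreover have "list_all2 (\<in>) l (map set (zss[m := [l ! m]]))"
      using l len assms(2) by (auto simp: list_all2_conv_all_nth nth_list_update)
    ultimately show False
      using lB by (auto simp: mem_listset_iff)
  qed
  also have "\<dots> = ks ! m * card X ^ sum_list (ks[m := 0])"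
    using assms(1) by (simp add: card_grids)
  finally show ?thesis .
qed

text \<open>Both bounds on \<open>grids_in X (ks[m := 1]) B\<close> are compared after
  multiplication by \<open>card X\<close>. In the constant, the squares account for degenerate grids
  and \<open>ks ! m\<close> for distinct ones.\<close>

lemma grid_free_density:
  assumes "finite X" "X \<noteq> {}" "m < length ks" "ks ! m > 0" "B \<subseteq> tuples X (length ks)"
    and free: "\<And>Ss. list_all2 (\<lambda>S k. S \<subseteq> X \<and> card S = k) Ss ks \<Longrightarrow> \<not> listset Ss \<subseteq> B"
  shows "real (card X) * (card B / real (card X) ^ length ks) ^ prod_list (ks[m := 1])
    \<le> real ((\<Sum>k\<leftarrow>ks[m := 1]. k\<^sup>2) + ks ! m)"
proof -
  let ?ks = "ks[m := 1]" and ?n = "card X"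
  let ?c = "\<Sum>k\<leftarrow>?ks. k\<^sup>2"
  have n: "?n > 0"
    using assms by (simp add: card_gt_0_iff)
  \<comment> \<open>The single value in coordinate \<open>m\<close> supplies the extra factor
    \<open>?n\<close> that is gained over the count of distinct grids.\<close>
  have s: "sum_list ?ks = Suc (sum_list (ks[m := 0]))"
    using assms(3) elem_le_sum_list[of m ks] by (simp add: sum_list_update)
  have "grids_in X ?ks B \<subseteq> {xss \<in> grids_in X ?ks B. list_all distinct xss}
      \<union> {xss \<in> grids X ?ks. \<not> list_all distinct xss}"
    by (auto simp: grids_in_def)
  moreover have "finite ({xss \<in> grids_in X ?ks B. list_all distinct xss}
      \<union> {xss \<in> grids X ?ks. \<not> list_all distinct xss})"
    using assms(1) by (auto simp: finite_grids finite_grids_in)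
  ultimately have "card (grids_in X ?ks B) \<le> card {xss \<in> grids_in X ?ks B. list_all distinct xss}
      + card {xss \<in> grids X ?ks. \<not> list_all distinct xss}"
    by (meson card_Un_le card_mono le_trans)
  also have "\<dots> \<le> ks ! m * ?n ^ sum_list (ks[m := 0]) + card {xss \<in> grids X ?ks. \<not> list_all distinct xss}"
    using card_distinct_grids_in[OF assms(1,3,4) free] by simp
  finally have "card (grids_in X ?ks B) * ?n
      \<le> (ks ! m * ?n ^ sum_list (ks[m := 0]) + card {xss \<in> grids X ?ks. \<not> list_all distinct xss}) * ?n"
    by (rule mult_right_mono) simp
  also have "\<dots> \<le> (?c + ks ! m) * ?n ^ sum_list ?ks"
    using card_nondistinct_grids[OF assms(1), of ?ks] unfolding s by (simp add: algebra_simps)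
  finally have "real (card (grids_in X ?ks B)) * ?n \<le> real (?c + ks ! m) * real ?n ^ sum_list ?ks"
    by (metis of_nat_le_iff of_nat_mult of_nat_power)
  moreover have "real ?n ^ sum_list ?ks * (card B / real ?n ^ length ks) ^ prod_list ?ks
      \<le> card (grids_in X ?ks B)"
    using card_grids_in_ge[OF assms(1,2), of B ?ks] assms(5) by simp
  then have "real ?n ^ sum_list ?ks * (card B / real ?n ^ length ks) ^ prod_list ?ks * ?n
      \<le> card (grids_in X ?ks B) * real ?n"
    by (rule mult_right_mono) simp
  ultimately have "real ?n ^ sum_list ?ks * (real ?n * (card B / real ?n ^ length ks) ^ prod_list ?ks)
      \<le> real ?n ^ sum_list ?ks * real (?c + ks ! m)"
    by (simp add: algebra_simps)
  then show ?thesis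
    using n by (subst (asm) mult_le_cancel_left_pos) auto
qed

lemma prod_list_eq_nth_mult:
  fixes ks :: "'a::comm_monoid_mult list"
  assumes "m < length ks"
  shows "prod_list ks = ks ! m * prod_list (ks[m := 1])"
  using assms
proof (induction ks arbitrary: m)
  case (Cons k ks)
  then show ?case
    by (cases m) (auto simp: mult.left_commute)
qed simp

section \<open>Matrices as sets of positions\<close>

lemma positions_replicate: "positions (replicate d n) = tuples {1..n} d"
  by (fastforce simp: positions_def tuples_def mem_listset_iff list_all2_conv_all_nth in_set_conv_nth)

lemma selected_position_mem:
  fixes ns :: "nat list"
  assumes "list_all2 (\<lambda>S n. S \<subseteq> {1..n}) Ss ns" "js \<in> positions (map card Ss)"
  shows "map2 (\<lambda>S j. sorted_list_of_set S ! (j - 1)) Ss js \<in> listset Ss"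
  unfolding mem_listset_iff list_all2_conv_all_nth
proof (intro conjI allI impI)
  have len: "length js = length Ss"
    using assms(2) by (auto simp: positions_def mem_listset_iff dest: list_all2_lengthD)
  then show "length (map2 (\<lambda>S j. sorted_list_of_set S ! (j - 1)) Ss js) = length Ss"
    by simp
  fix i assume "i < length (map2 (\<lambda>S j. sorted_list_of_set S ! (j - 1)) Ss js)"
  then have i: "i < length Ss"
    by simp
  then have "Ss ! i \<subseteq> {1..ns ! i}"
    using assms(1) by (simp add: list_all2_conv_all_nth)
  then have fin: "finite (Ss ! i)"
    by (rule finite_subset) simp
  \<comment> \<open>Positions count from 1 and list indices from 0, so the range from 1 to
    \<open>card (Ss ! i)\<close> becomes the valid index range.\<close>
  have "js ! i - 1 < card (Ss ! i)"
    using assms(2) i by (fastforce simp: positions_def mem_listset_iff list_all2_conv_all_nth)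
  then have "sorted_list_of_set (Ss ! i) ! (js ! i - 1) \<in> set (sorted_list_of_set (Ss ! i))"
    using fin by (intro nth_mem) simp
  then show "map2 (\<lambda>S j. sorted_list_of_set S ! (j - 1)) Ss js ! i \<in> Ss ! i"
    using fin i len by simp
qed

text \<open>For an all-ones pattern the order of the selected values is immaterial: every entry of
  the submatrix comes from a point of the box \<open>listset Ss\<close>, and no one has to be
  changed.\<close>

lemma contains_all_onesI:
  assumes "list_all2 (\<lambda>S n. S \<subseteq> {1..n}) Ss (dims A)" "map card Ss = ks"
    and "\<And>l. l \<in> listset Ss \<Longrightarrow> entry A l = 1"
  shows "contains A (all_ones ks)"
  unfolding contains_def
proof (intro exI conjI)
  show "selection A Ss"
    using assms(1) by (simp add: selection_def)
  show "ones_to_zeros (submatrix A Ss) (all_ones ks)"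
    using assms(3)[OF selected_position_mem[OF assms(1)]]
    by (auto simp: ones_to_zeros_def submatrix_def all_ones_def assms(2)[symmetric])
qed

text \<open>Positive sides give the pattern a position, where it has a one that the zero matrix
  cannot supply. This makes the set under \<open>Max\<close> nonempty.\<close>

lemma zero_matrix_avoids_all_ones:
  assumes "\<forall>k \<in> set ks. k > 0"
  shows "avoids (Matrix ns (\<lambda>i \<in> positions ns. 0)) (all_ones ks)"
proof
  let ?A = "Matrix ns (\<lambda>i \<in> positions ns. 0)"
  assume "contains ?A (all_ones ks)"
  then obtain Ss where S: "list_all2 (\<lambda>S n. S \<subseteq> {1..n}) Ss ns"
    and o: "ones_to_zeros (submatrix ?A Ss) (all_ones ks)"
    by (auto simp: contains_def selection_def)
  from o have ks: "ks = map card Ss"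
    by (simp add: ones_to_zeros_def submatrix_def all_ones_def)
  define j where "j = replicate (length ks) (1::nat)"
  have j: "j \<in> positions (map card Ss)"
    using assms by (auto simp: positions_def mem_listset_iff list_all2_conv_all_nth j_def ks Suc_le_eq)
  let ?i = "map2 (\<lambda>S j. sorted_list_of_set S ! (j - 1)) Ss j"
  have "list_all2 (\<in>) ?i Ss"
    using selected_position_mem[OF S j] by (simp only: mem_listset_iff)
  \<comment> \<open>The source position must lie in \<open>positions ns\<close>, because the
    restricted function is \<open>undefined\<close> elsewhere.\<close>
  then have "list_all2 (\<in>) ?i (map (\<lambda>n. {1..n}) ns)"
    unfolding list.rel_map using S by (rule list_all2_trans[rotated]) blast
  then have "?i \<in> positions ns"
    by (simp only: positions_def mem_listset_iff)
  then have "entry (submatrix ?A Ss) j = 0"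
    using j by (simp add: submatrix_def)
  moreover have "entry (all_ones ks) j = 1"
    using j by (simp add: all_ones_def ks)
  ultimately show False
    using o j by (auto simp: ones_to_zeros_def submatrix_def)
qed

text \<open>\<open>Max\<close> is meaningful only for finite nonempty sets; with both checked, an
  extremal matrix can be fixed.\<close>

lemma max_ones_attained:
  assumes "\<forall>k \<in> set ks. k > 0"
  obtains A where "A \<in> zero_one_matrices (replicate d n)" "avoids A (all_ones ks)"
    "max_ones n (all_ones ks) d = num_ones A"
proof -
  let ?P = "positions (replicate d n)"
  let ?M = "{num_ones A | A. A \<in> zero_one_matrices (replicate d n) \<and> avoids A (all_ones ks)}"
  have "finite ?P"
    by (simp add: positions_replicate finite_tuples)
  then have "?M \<subseteq> {..card ?P}"
    by (auto simp: zero_one_matrices_def num_ones_def intro: card_mono)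
  then have "finite ?M"
    by (rule finite_subset) simp
  moreover have "Matrix (replicate d n) (\<lambda>i \<in> ?P. 0) \<in> zero_one_matrices (replicate d n)"
    by (auto simp: zero_one_matrices_def)
  then have "?M \<noteq> {}"
    using zero_matrix_avoids_all_ones[OF assms] by blast
  ultimately have "max_ones n (all_ones ks) d \<in> ?M"
    unfolding max_ones_def by (rule Max_in)
  then show ?thesis
    using that by auto
qed

section \<open>The asymptotic bound\<close>

theorem theorem2p2:
  fixes d :: nat and ks :: "nat list"
  assumes "d \<ge> 1"
    and "length ks = d"
    and "\<forall>k \<in> set ks. k > 0"
  shows "(\<lambda>n. real (max_ones n (all_ones ks) d)) \<in> O(\<lambda>n. real n powr (real d - alpha ks))"
proof -
  have "Max (set ks) \<in> set ks"
    using assms by (intro Max_in) auto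
  \<comment> \<open>The density bound holds for any coordinate of positive side; a longest side
    makes the product \<open>K\<close> of the others smallest and turns \<open>1 / K\<close> into
    \<open>alpha ks\<close>.\<close>
  then obtain m where m: "m < length ks" "ks ! m = Max (set ks)"
    by (auto simp: in_set_conv_nth)
  then have pos: "ks ! m > 0"
    using assms(3) nth_mem by blast
  define K where "K = prod_list (ks[m := 1])"
  define C where "C = real ((\<Sum>k\<leftarrow>ks[m := 1]. k\<^sup>2) + ks ! m)"
  have "prod_list ks > 0"
    using assms(3) by (induction ks) auto
  then have K: "K > 0"
    using prod_list_eq_nth_mult[OF m(1)] by (auto simp: K_def)
  have alpha: "alpha ks = 1 / K"
    using prod_list_eq_nth_mult[OF m(1)] m(2) pos by (simp add: alpha_def K_def)
  have bound: "real (max_ones n (all_ones ks) d) \<le> C powr (1 / K) * real n powr (d - alpha ks)"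
    if n: "n > 0" for n
  proof -
    obtain A where A: "A \<in> zero_one_matrices (replicate d n)" "avoids A (all_ones ks)"
      and max: "max_ones n (all_ones ks) d = num_ones A"
      using max_ones_attained[OF assms(3)] .
    have dims: "dims A = replicate d n"
      using A by (simp add: zero_one_matrices_def)
    let ?B = "{i \<in> positions (dims A). entry A i = 1}"
    define \<delta> where "\<delta> = real (num_ones A) / real n ^ d"
    have "\<not> listset Ss \<subseteq> ?B" if "list_all2 (\<lambda>S k. S \<subseteq> {1..n} \<and> card S = k) Ss ks" for Ss
    proof
      assume "listset Ss \<subseteq> ?B"
      moreover have "list_all2 (\<lambda>S n. S \<subseteq> {1..n}) Ss (dims A)" "map card Ss = ks"
        using that assms(2) by (auto simp: dims list_all2_conv_all_nth intro: nth_equalityI)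
      ultimately have "contains A (all_ones ks)"
        by (intro contains_all_onesI) auto
      with A show False
        by simp
    qed
    \<comment> \<open>The ones of an avoiding matrix contain no full box with sides
      \<open>ks\<close>, so the density bound applies to them with
      \<open>X = {1..n}\<close>.\<close>
    then have "n * \<delta> ^ K \<le> C"
      using grid_free_density[of "{1..n}" m ks ?B] n m(1) pos assms(2)
      by (simp add: \<delta>_def K_def C_def num_ones_def dims positions_replicate)
    then have "\<delta> ^ K \<le> C / n"
      using n by (simp add: field_simps)
    then have "root K (\<delta> ^ K) \<le> root K (C / n)"
      using K by simp
    moreover have "root K (\<delta> ^ K) = \<delta>"
      using K by (simp add: real_root_power_cancel \<delta>_def)
    moreover have "C > 0"
      using pos by (simp add: C_def)
    ultimately have "\<delta> \<le> (C / n) powr (1 / K)"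
      using K n by (simp add: root_powr_inverse)
    then have "num_ones A \<le> real n ^ d * (C / n) powr (1 / K)"
      using n by (simp add: \<delta>_def field_simps)
    \<comment> \<open>The factor \<open>n powr (- 1 / K)\<close> from the density lowers the
      exponent \<open>d\<close> by exactly \<open>alpha ks\<close>.\<close>
    also have "\<dots> = C powr (1 / K) * real n powr (d - alpha ks)"
      using n \<open>C > 0\<close> by (simp add: alpha powr_diff powr_divide powr_realpow)
    finally show ?thesis
      by (simp add: max)
  qed
  show ?thesis
  proof (rule bigoI)
    show "\<forall>\<^sub>F n in sequentially. norm (real (max_ones n (all_ones ks) d))
        \<le> C powr (1 / K) * norm (real n powr (real d - alpha ks))"
      using eventually_gt_at_top[of 0] by eventually_elim (use bound in simp)
  qed
qed

end
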